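(* (a) (Type I model.) Let $\mu$ be a probability measure on $\mathcal{X}_0$ with $\mu^{\mathbb{Z}}(\mathcal{X}^* )=1$, and let $\nu$ be the distribution of $U_{-1}(x)$ where $x\sim\mu^{\mathbb{Z}}$. Then $\mathcal{T}\mu^{\mathbb{Z}}=\mu^{\mathbb{Z}}$ if and only if $F(\mu\times\nu)=\mu\times\nu$. (b) (Type II model.) Let $\mu,\tilde\mu$ be probability measures on $\mathcal{X}_0,\tilde{\mathcal{X}}_0$ with $(\mu\times\tilde\mu)^{\mathbb{Z}}(\mathcal{X}^* )=1$, and let $\nu,\tilde\nu$ be the distributions of $U_{-1}(x)$ and $U_0(x)$ respectively, where $x\sim(\mu\times\tilde\mu)^{\mathbb{Z}}$. Then $\mathcal{T}(\mu\times\tilde\mu)^{\mathbb{Z}}=(\mu\times\tilde\mu)^{\mathbb{Z}}$ if and only if $F_*(\mu\times\nu)=\tilde\mu\times\tilde\nu$.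
   Context: Type I model: $\mathcal{X}_0,\mathcal{U}_0$ are Polish spaces and $F:\mathcal{X}_0\times\mathcal{U}_0\to\mathcal{X}_0\times\mathcal{U}_0$ is an involution; set $F_n^t:=F$ for all $n,t\in\mathbb{Z}$, and configurations are elements $x=(x_n)_{n\in\mathbb{Z}}\in\mathcal{X}_0^{\mathbb{Z}}$. Type II model: $\mathcal{X}_0,\tilde{\mathcal{X}}_0,\mathcal{U}_0,\tilde{\mathcal{U}}_0$ are Polish spaces and $F_*:\mathcal{X}_0\times\mathcal{U}_0\to\tilde{\mathcal{X}}_0\times\tilde{\mathcal{U}}_0$ is a bijection; set $F_n^t:=F_*$ if $n+t$ is even and $F_n^t:=F_*^{-1}$ if $n+t$ is odd; lattice variables satisfy $x_n^t\in\mathcal{X}_0$, $u_n^t\in\tilde{\mathcal{U}}_0$ if $n+t$ is even and $x_n^t\in\tilde{\mathcal{X}}_0$, $u_n^t\in\mathcal{U}_0$ if $n+t$ is odd; configurations are $x=(x_n)_{n\in\mathbb{Z}}$ with $x_n\in\mathcal{X}_0$ for $n$ even and $x_n\in\tilde{\mathcal{X}}_0$ for $n$ odd, and $(\mu\times\tilde\mu)^{\mathbb{Z}}$ denotes the product law under which $x_n\sim\mu$ for even $n$ and $x_n\sim\tilde\mu$ for odd $n$, all independent. In either case, $\mathcal{X}^*$ is the set of configurations $x$ for which there is a unique family $(x_n^t,u_n^t)_{n,t\in\mathbb{Z}}$ with $F_n^t(x_n^t,u_{n-1}^t)=(x_n^{t+1},u_n^t)$ for all $n,t\in\mathbb{Z}$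 and $x_n^0=x_n$ for all $n$. For $x\in\mathcal{X}^*$, $U_n(x):=u_n^0$, and the one-step dynamics is $\mathcal{T}(x)_n:=x_n^1$ for a type I model and $\mathcal{T}(x)_n:=x_{n+1}^1$ for a type II model. $G(m):=m\circ G^{-1}$ denotes pushforward. *)

theory Defs
  imports "HOL-Probability.Probability"
begin

text \<open>A lattice family (x_n^t, u_n^t) is encoded as a pair of functions
  xx n t = x_n^t and uu n t = u_n^t. It solves the type I model with
  initial configuration x if F(x_n^t, u_{n-1}^t) = (x_n^{t+1}, u_n^t)
  for all n, t and x_n^0 = x_n.\<close>

definition sol1 :: "('x \<times> 'u \<Rightarrow> 'x \<times> 'u) \<Rightarrow> (int \<Rightarrow> 'x)
    \<Rightarrow> (int \<Rightarrow> int \<Rightarrow> 'x) \<times> (int \<Rightarrow> int \<Rightarrow> 'u) \<Rightarrow> bool" where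
  "sol1 F x fam \<longleftrightarrow>
     (\<forall>n t. F (fst fam n t, snd fam (n - 1) t) = (fst fam n (t + 1), snd fam n t))
     \<and> (\<forall>n. fst fam n 0 = x n)"

definition Xstar1 :: "('x \<times> 'u \<Rightarrow> 'x \<times> 'u) \<Rightarrow> (int \<Rightarrow> 'x) set" where
  "Xstar1 F = {x. \<exists>!fam. sol1 F x fam}"

definition U1 :: "('x \<times> 'u \<Rightarrow> 'x \<times> 'u) \<Rightarrow> int \<Rightarrow> (int \<Rightarrow> 'x) \<Rightarrow> 'u" where
  "U1 F n x = (if x \<in> Xstar1 F then snd (THE fam. sol1 F x fam) n 0 else undefined)"

definition T1 :: "('x \<times> 'u \<Rightarrow> 'x \<times> 'u) \<Rightarrow> (int \<Rightarrow> 'x) \<Rightarrow> (int \<Rightarrow> 'x)" where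
  "T1 F x = (if x \<in> Xstar1 F then (\<lambda>n. fst (THE fam. sol1 F x fam) n 1) else undefined)"

text \<open>Variables living in X_0 or tilde X_0 (depending on parity) are encoded in the
  sum type 'x + 'xt (Inl = element of X_0, Inr = element of tilde X_0);
  variables living in tilde U_0 or U_0 are encoded in 'ut + 'u
  (Inl = element of tilde U_0, Inr = element of U_0).
  For n+t even: F_*(x_n^t, u_{n-1}^t) = (x_n^{t+1}, u_n^t) with x_n^t in X_0,
  u_{n-1}^t in U_0, x_n^{t+1} in tilde X_0, u_n^t in tilde U_0;
  for n+t odd: F_*^{-1}(x_n^t, u_{n-1}^t) = (x_n^{t+1}, u_n^t) with the types swapped.
  These equations force every lattice variable to lie in the correct space.\<close>

definition sol2 :: "('x \<times> 'u \<Rightarrow> 'xt \<times> 'ut) \<Rightarrow> (int \<Rightarrow> 'x + 'xt)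
    \<Rightarrow> (int \<Rightarrow> int \<Rightarrow> 'x + 'xt) \<times> (int \<Rightarrow> int \<Rightarrow> 'ut + 'u) \<Rightarrow> bool" where
  "sol2 Fs x fam \<longleftrightarrow>
     (\<forall>n t. even (n + t) \<longrightarrow>
        (\<exists>a b. fst fam n t = Inl a \<and> snd fam (n - 1) t = Inr b
             \<and> fst fam n (t + 1) = Inr (fst (Fs (a, b)))
             \<and> snd fam n t = Inl (snd (Fs (a, b)))))
     \<and> (\<forall>n t. odd (n + t) \<longrightarrow>
        (\<exists>a b. fst fam n t = Inr a \<and> snd fam (n - 1) t = Inl b
             \<and> fst fam n (t + 1) = Inl (fst (inv Fs (a, b)))
             \<and> snd fam n t = Inr (snd (inv Fs (a, b)))))
     \<and> (\<forall>n. fst fam n 0 = x n)"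

definition Config2 :: "(int \<Rightarrow> 'x + 'xt) set" where
  "Config2 = {x. \<forall>n. (even n \<longrightarrow> x n \<in> range Inl) \<and> (odd n \<longrightarrow> x n \<in> range Inr)}"

definition Xstar2 :: "('x \<times> 'u \<Rightarrow> 'xt \<times> 'ut) \<Rightarrow> (int \<Rightarrow> 'x + 'xt) set" where
  "Xstar2 Fs = {x \<in> Config2. \<exists>!fam. sol2 Fs x fam}"

definition U2 :: "('x \<times> 'u \<Rightarrow> 'xt \<times> 'ut) \<Rightarrow> int \<Rightarrow> (int \<Rightarrow> 'x + 'xt) \<Rightarrow> 'ut + 'u" where
  "U2 Fs n x = (if x \<in> Xstar2 Fs then snd (THE fam. sol2 Fs x fam) n 0 else undefined)"

definition T2 :: "('x \<times> 'u \<Rightarrow> 'xt \<times> 'ut) \<Rightarrow> (int \<Rightarrow> 'x + 'xt) \<Rightarrow> (int \<Rightarrow> 'x + 'xt)" where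
  "T2 Fs x = (if x \<in> Xstar2 Fs then (\<lambda>n. fst (THE fam. sol2 Fs x fam) (n + 1) 1) else undefined)"

definition sum_borel :: "('a::topological_space + 'b::topological_space) measure" where
  "sum_borel = sigma UNIV ((\<lambda>A. Inl ` A) ` sets borel \<union> (\<lambda>B. Inr ` B) ` sets borel)"

definition alt_prod :: "'a::topological_space measure \<Rightarrow> 'b::topological_space measure
    \<Rightarrow> (int \<Rightarrow> 'a + 'b) measure" where
  "alt_prod mu mut = PiM UNIV (\<lambda>n::int. if even n then distr mu sum_borel Inl else distr mut sum_borel Inr)"

end

theory Submission
  imports Defs
begin

text \<open>Both models are instances of one involutive lattice equation whose variables live in sets depending
  on the parity of \<open>n + t\<close>; its one-step map uses the type II convention, which for a type I model
  differs from the given dynamics by a spatial shift that preserves the product law.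

  Uniqueness of the solution forces causality: \<open>U\<^sub>n(x)\<close> depends only on \<open>(x\<^sub>i)\<close> with \<open>i \<le> n\<close>, so \<open>x\<^sub>0\<close> and
  \<open>U\<^sub>-\<^sub>1\<close> are independent. If the product law is invariant, reflect the configuration \<open>T x\<close> in space:
  the result \<open>z\<close> again has the product law, and by uniqueness for \<open>z\<close> the outgoing pair
  \<open>F(x\<^sub>0, U\<^sub>-\<^sub>1 x)\<close> equals \<open>(z\<^sub>1, U\<^sub>0 z)\<close>, whose law is the required product. Conversely, starting from
  a column far to the left and using the local balance column by column, the updated variables so far
  stay independent of the current carrier and have the right product law, which gives all
  finite-dimensional distributions of \<open>T x\<close>.\<close>

section \<open>The lattice equation on parity-typed variables\<close>

locale lattice =
  fixes F :: "'a \<times> 'b \<Rightarrow> 'a \<times> 'b" and SX :: "bool \<Rightarrow> 'a set" and SU :: "bool \<Rightarrow> 'b set"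
  assumes involution: "F (F p) = p"
    and F_maps: "a \<in> SX e \<Longrightarrow> b \<in> SU (\<not> e) \<Longrightarrow> fst (F (a, b)) \<in> SX (\<not> e) \<and> snd (F (a, b)) \<in> SU e"
begin

text \<open>The Boolean index is the parity of \<open>n + t\<close>. The incoming carrier sits at
  \<open>(n - 1, t)\<close>, so its parity is opposite to that of the site it meets; this is why
  \<open>F_maps\<close> pairs \<open>SX e\<close> with \<open>SU (\<not> e)\<close>. Type I takes
  all sets to be \<open>UNIV\<close>.\<close>

definition solution :: "(int \<Rightarrow> 'a) \<Rightarrow> (int \<Rightarrow> int \<Rightarrow> 'a) \<times> (int \<Rightarrow> int \<Rightarrow> 'b) \<Rightarrow> bool" where
  "solution x fam \<longleftrightarrow>
     (\<forall>n t. F (fst fam n t, snd fam (n - 1) t) = (fst fam n (t + 1), snd fam n t)) \<and>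
     (\<forall>n. fst fam n 0 = x n) \<and>
     (\<forall>n t. fst fam n t \<in> SX (even (n + t)) \<and> snd fam n t \<in> SU (even (n + t)))"

definition Xstar :: "(int \<Rightarrow> 'a) set" where
  "Xstar = {x. \<exists>!fam. solution x fam}"

definition fam_of :: "(int \<Rightarrow> 'a) \<Rightarrow> (int \<Rightarrow> int \<Rightarrow> 'a) \<times> (int \<Rightarrow> int \<Rightarrow> 'b)" where
  "fam_of x = (THE fam. solution x fam)"

definition U :: "int \<Rightarrow> (int \<Rightarrow> 'a) \<Rightarrow> 'b" where
  "U n x = (if x \<in> Xstar then snd (fam_of x) n 0 else undefined)"

definition T :: "(int \<Rightarrow> 'a) \<Rightarrow> int \<Rightarrow> 'a" where
  "T x = (if x \<in> Xstar then (\<lambda>n. fst (fam_of x) (n + 1) 1) else undefined)"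

lemma solution_fam_of: "x \<in> Xstar \<Longrightarrow> solution x (fam_of x)"
  unfolding Xstar_def fam_of_def by (auto intro: theI')

lemma fam_of_eqI: "x \<in> Xstar \<Longrightarrow> solution x fam \<Longrightarrow> fam_of x = fam"
  unfolding Xstar_def using solution_fam_of[of x] by (auto simp: Xstar_def)

lemma solutionD:
  assumes "solution x fam"
  shows "F (fst fam n t, snd fam (n - 1) t) = (fst fam n (t + 1), snd fam n t)"
    and "fst fam n 0 = x n"
    and "fst fam n t \<in> SX (even (n + t))" and "snd fam n t \<in> SU (even (n + t))"
  using assms by (auto simp: solution_def)

lemma one_step:
  assumes "x \<in> Xstar"
  shows "F (x n, U (n - 1) x) = (T x (n - 1), U n x)"
  using solutionD(1)[OF solution_fam_of[OF assms], of n 0]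
    solutionD(2)[OF solution_fam_of[OF assms], of n] assms
  by (simp add: U_def T_def)

lemma T_eq: "x \<in> Xstar \<Longrightarrow> T x n = fst (F (x (n + 1), U n x))"
  using one_step[of x "n + 1"] by simp

section \<open>Causality of the carriers\<close>

text \<open>\<open>column a c\<close> is the future of a site started at \<open>a\<close> and fed the carriers \<open>c\<close> from its left.\<close>

primrec column :: "'a \<Rightarrow> (nat \<Rightarrow> 'b) \<Rightarrow> nat \<Rightarrow> 'a" where
  "column a c 0 = a"
| "column a c (Suc t) = fst (F (column a c t, c t))"

text \<open>Stage \<open>i\<close> is the carrier history entering site \<open>i\<close>. Whole
  histories are passed on, because a site must be followed through all earlier times before its
  outgoing carrier at time \<open>t\<close> is known.\<close>

primrec carrier_seq :: "(nat \<Rightarrow> 'a) \<Rightarrow> (nat \<Rightarrow> 'b) \<Rightarrow> nat \<Rightarrow> nat \<Rightarrow> 'b" where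
  "carrier_seq y c 0 = c"
| "carrier_seq y c (Suc i) = (\<lambda>t. snd (F (column (y i) (carrier_seq y c i) t, carrier_seq y c i t)))"

lemma column_type:
  assumes "a \<in> SX e" and "\<And>t. c t \<in> SU (even t \<longleftrightarrow> \<not> e)"
  shows "column a c t \<in> SX (even t \<longleftrightarrow> e)"
proof (induction t)
  case 0
  then show ?case using assms by simp
next
  case (Suc t)
  from F_maps[OF Suc, of "c t"] assms(2)[of t] show ?case
    by (cases "even t"; cases e) auto
qed

lemma carrier_seq_type:
  assumes "\<And>i. y i \<in> SX (even i \<longleftrightarrow> e)" and "\<And>t. c t \<in> SU (even t \<longleftrightarrow> \<not> e)"
  shows "carrier_seq y c i t \<in> SU (even (i + t) \<longleftrightarrow> \<not> e)"
proof (induction i arbitrary: t)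
  case 0
  then show ?case using assms by simp
next
  case (Suc i)
  have "column (y i) (carrier_seq y c i) t \<in> SX (even t \<longleftrightarrow> (even i \<longleftrightarrow> e))"
  proof (rule column_type[OF assms(1)])
    fix t
    have "(even (i + t) \<longleftrightarrow> \<not> e) = (even t \<longleftrightarrow> \<not> (even i \<longleftrightarrow> e))" by auto
    with Suc[of t] show "carrier_seq y c i t \<in> SU (even t \<longleftrightarrow> \<not> (even i \<longleftrightarrow> e))" by simp
  qed
  from F_maps[OF this, of "carrier_seq y c i t"] Suc[of t] show ?case
    by (cases "even t"; cases "even i"; cases e) auto
qed

text \<open>Below the time axis the solution of \<open>y\<close> is kept; above it the solution of \<open>x\<close> on the columns
  up to \<open>k\<close> drives the columns to the right of \<open>k\<close>, which start from \<open>y\<close>. By uniqueness the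
  result is the solution of \<open>y\<close>.\<close>

lemma causality:
  assumes x: "x \<in> Xstar" and y: "y \<in> Xstar" and eq: "\<And>n. n \<le> k \<Longrightarrow> x n = y n"
  shows "U k x = U k y"
proof -
  let ?f = "fam_of x" and ?g = "fam_of y"
  note f = solutionD[OF solution_fam_of[OF x]] and g = solutionD[OF solution_fam_of[OF y]]
  \<comment> \<open>Columns to the right of \<open>k\<close> are numbered from 0, and
    \<open>c\<close> is the history that the solution of \<open>x\<close> sends out of column
    \<open>k\<close>.\<close>
  define r where "r i = y (k + 1 + int i)" for i
  define c where "c t = snd ?f k (int t)" for t
  define cs where "cs = carrier_seq r c"
  define h1 where "h1 n t = (if t < 0 then fst ?g n t else if n \<le> k then fst ?f n t
    else column (y n) (cs (nat (n - k - 1))) (nat t))" for n t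
  define h2 where "h2 n t = (if t < 0 then snd ?g n t else if n \<le> k then snd ?f n t
    else cs (nat (n - k)) (nat t))" for n t
  have ry: "r i \<in> SX (even i \<longleftrightarrow> odd k)" for i
  proof -
    have "even (k + 1 + int i + 0) = (even i \<longleftrightarrow> odd k)" by auto
    with g(3)[of "k + 1 + int i" 0] show ?thesis by (simp only: r_def g(2))
  qed
  have ct: "c t \<in> SU (even t \<longleftrightarrow> \<not> odd k)" for t
  proof -
    have "even (k + int t) = (even t \<longleftrightarrow> \<not> odd k)" by auto
    with f(4)[of k "int t"] show ?thesis by (simp only: c_def)
  qed
  have cst: "cs i t \<in> SU (even (i + t) \<longleftrightarrow> \<not> odd k)" for i t
    unfolding cs_def by (rule carrier_seq_type[OF ry ct])
  have h10: "h1 n 0 = y n" for n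
    using eq[of n] by (auto simp: h1_def f(2) g(2))
  have col: "column (y n) (cs (nat (n - k - 1))) t \<in> SX (even t \<longleftrightarrow> even n)"
    if n: "n > k" for n t
  proof (rule column_type)
    show "y n \<in> SX (even n)" using g(3)[of n 0] by (simp add: g(2))
    show "cs (nat (n - k - 1)) t \<in> SU (even t \<longleftrightarrow> \<not> even n)" for t
    proof -
      have "(even (nat (n - k - 1) + t) \<longleftrightarrow> \<not> odd k) = (even t \<longleftrightarrow> \<not> even n)"
        using n by (auto simp: even_nat_iff)
      with cst[of "nat (n - k - 1)" t] show ?thesis by simp
    qed
  qed
  have "solution y (h1, h2)"
    unfolding solution_def fst_conv snd_conv
  proof (intro conjI allI)
    fix n t :: int
    show "h1 n 0 = y n" by (rule h10)
    show "h1 n t \<in> SX (even (n + t))"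
    proof -
      have "(even (nat t) \<longleftrightarrow> even n) = even (n + t)" if "\<not> t < 0"
        using that by (auto simp: even_nat_iff)
      then show ?thesis
        using f(3)[of n t] g(3)[of n t] col[of n "nat t"] by (auto simp: h1_def)
    qed
    show "h2 n t \<in> SU (even (n + t))"
    proof -
      have "(even (nat (n - k) + nat t) \<longleftrightarrow> \<not> odd k) = even (n + t)" if "\<not> t < 0" "\<not> n \<le> k"
        using that by (auto simp: even_nat_iff)
      then show ?thesis
        using f(4)[of n t] g(4)[of n t] cst[of "nat (n - k)" "nat t"] by (auto simp: h2_def)
    qed
    consider (neg) "t < 0" | (left) "t \<ge> 0" "n \<le> k" | (right) "t \<ge> 0" "n > k" by linarith
    then show "F (h1 n t, h2 (n - 1) t) = (h1 n (t + 1), h2 n t)"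
    proof cases
      case neg
      \<comment> \<open>The seam between the two half-planes is crossed only at
        \<open>t = -1\<close>, where both descriptions give \<open>y n\<close>.\<close>
      have "h1 n (t + 1) = fst ?g n (t + 1)"
      proof (cases "t = -1")
        case True
        then show ?thesis using h10[of n] by (simp add: g(2))
      qed (use neg in \<open>simp add: h1_def\<close>)
      with neg show ?thesis by (simp add: h1_def h2_def g(1))
    next
      case left
      then show ?thesis by (simp add: h1_def h2_def f(1))
    next
      case right
      \<comment> \<open>At the seam \<open>n = k + 1\<close> the incoming carrier comes from the
        left region; it agrees with stage 0 of the sequence.\<close>
      have c0: "cs 0 = c" by (simp add: cs_def)
      have h2': "h2 (n - 1) t = cs (nat (n - k - 1)) (nat t)"
        using right by (cases "n = k + 1") (auto simp: h2_def c0 c_def algebra_simps)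
      have "r (nat (n - k - 1)) = y n" using right by (simp add: r_def)
      moreover have "nat (n - k) = Suc (nat (n - k - 1))" "nat (t + 1) = Suc (nat t)"
        using right by simp_all
      ultimately show ?thesis using right unfolding h2' by (simp add: h1_def h2_def cs_def)
    qed
  qed
  then have "?g = (h1, h2)" by (rule fam_of_eqI[OF y])
  \<comment> \<open>The point \<open>(k, 0)\<close> lies in the left region, where \<open>h2\<close>
    was taken from the solution of \<open>x\<close>.\<close>
  then have "snd ?g k 0 = snd ?f k 0" by (simp add: h2_def)
  then show ?thesis using x y by (simp add: U_def)
qed

section \<open>Symmetries: space-time reflection and translations\<close>

text \<open>Any solution of \<open>y\<close> is pulled back by \<open>h\<close> to the only solution
  of \<open>x\<close>, and applying \<open>g\<close> recovers it; hence it must be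
  \<open>g (fam_of x)\<close>.\<close>

lemma Xstar_transfer:
  assumes g: "\<And>fam. solution x fam \<Longrightarrow> solution y (g fam)"
    and h: "\<And>fam. solution y fam \<Longrightarrow> solution x (h fam)"
    and gh: "\<And>fam. g (h fam) = fam" and x: "x \<in> Xstar"
  shows "y \<in> Xstar" and "fam_of y = g (fam_of x)"
proof -
  have *: "fam = g (fam_of x)" if "solution y fam" for fam
    using fam_of_eqI[OF x h[OF that]] gh[of fam] by simp
  then show y: "y \<in> Xstar"
    unfolding Xstar_def using g[OF solution_fam_of[OF x]] by blast
  show "fam_of y = g (fam_of x)"
    by (rule *[OF solution_fam_of[OF y]])
qed

text \<open>Reversing both space and time inverts each local equation, and an involution is its own
  inverse. The carrier \<open>u_n^t\<close> lives between columns \<open>n\<close> and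
  \<open>n + 1\<close> and between times \<open>t\<close> and \<open>t + 1\<close>, so reflection
  moves its indices to \<open>- n - 1\<close> and \<open>- t - 1\<close>.\<close>

lemma reflection:
  assumes x: "x \<in> Xstar"
  shows "(\<lambda>n. x (- n)) \<in> Xstar"
    and "U n (\<lambda>n. x (- n)) = snd (fam_of x) (- n - 1) (- 1)"
proof -
  define R :: "(int \<Rightarrow> int \<Rightarrow> 'a) \<times> (int \<Rightarrow> int \<Rightarrow> 'b) \<Rightarrow> (int \<Rightarrow> int \<Rightarrow> 'a) \<times> (int \<Rightarrow> int \<Rightarrow> 'b)"
    where "R fam = ((\<lambda>n t. fst fam (- n) (- t)), (\<lambda>n t. snd fam (- n - 1) (- t - 1)))" for fam
  have R: "solution (\<lambda>n. z (- n)) (R fam)" if z: "solution z fam" for z fam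
    unfolding solution_def R_def fst_conv snd_conv
  proof (intro conjI allI)
    fix n t :: int
    have "F (fst fam (- n) (- t - 1), snd fam (- n - 1) (- t - 1)) =
      (fst fam (- n) (- t), snd fam (- n) (- t - 1))"
      using solutionD(1)[OF z, of "- n" "- t - 1"] by simp
    then have "F (fst fam (- n) (- t), snd fam (- n) (- t - 1)) =
      (fst fam (- n) (- t - 1), snd fam (- n - 1) (- t - 1))"
      using involution[of "(fst fam (- n) (- t - 1), snd fam (- n - 1) (- t - 1))"] by simp
    moreover have "- (n - 1) - 1 = - n" "- (t + 1) = - t - 1" by simp_all
    ultimately show "F (fst fam (- n) (- t), snd fam (- (n - 1) - 1) (- t - 1)) =
      (fst fam (- n) (- (t + 1)), snd fam (- n - 1) (- t - 1))"
      by (simp only:)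
    show "fst fam (- n) (- 0) = z (- n)" using solutionD(2)[OF z] by simp
    have "even (- n + - t) = even (n + t)" "even (- n - 1 + (- t - 1)) = even (n + t)" by auto
    with solutionD(3)[OF z, of "- n" "- t"] solutionD(4)[OF z, of "- n - 1" "- t - 1"]
    show "fst fam (- n) (- t) \<in> SX (even (n + t))" "snd fam (- n - 1) (- t - 1) \<in> SU (even (n + t))"
      by (simp_all only:)
  qed
  have RR: "R (R fam) = fam" for fam by (simp add: R_def)
  note * = Xstar_transfer[where g = R and h = R and y = "\<lambda>n. x (- n)", OF R[of x] _ RR x]
  have R': "solution x (R fam)" if "solution (\<lambda>n. x (- n)) fam" for fam
    using R[OF that] by simp
  show 1: "(\<lambda>n. x (- n)) \<in> Xstar" by (rule *(1)) (auto intro: R')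
  have "fam_of (\<lambda>n. x (- n)) = R (fam_of x)" by (rule *(2)) (auto intro: R')
  then show "U n (\<lambda>n. x (- n)) = snd (fam_of x) (- n - 1) (- 1)"
    using 1 by (simp add: U_def R_def)
qed

text \<open>Even shifts always qualify; when the typing is constant, as in type I, every shift
  does.\<close>

definition compatible_shift :: "int \<Rightarrow> bool" where
  "compatible_shift a \<longleftrightarrow> (\<forall>n. SX (even (n + a)) = SX (even n) \<and> SU (even (n + a)) = SU (even n))"

lemma compatible_shift_even: "even a \<Longrightarrow> compatible_shift a"
  by (simp add: compatible_shift_def)

lemma compatible_shift_uminus: "compatible_shift a \<Longrightarrow> compatible_shift (- a)"
  unfolding compatible_shift_def
proof (intro allI)
  fix n
  assume "\<forall>n. SX (even (n + a)) = SX (even n) \<and> SU (even (n + a)) = SU (even n)"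
  then show "SX (even (n + - a)) = SX (even n) \<and> SU (even (n + - a)) = SU (even n)"
    using spec[of _ "n + - a"] by auto
qed

text \<open>Typing sees only the parity of \<open>n + t\<close>, so the condition concerns
  \<open>a + b\<close>. In particular the diagonal shift by \<open>(1, 1)\<close> is always
  allowed.\<close>

lemma solution_shift:
  assumes z: "solution z fam" and ab: "compatible_shift (a + b)"
  shows "solution (\<lambda>n. fst fam (n + a) b) (\<lambda>n t. fst fam (n + a) (t + b), \<lambda>n t. snd fam (n + a) (t + b))"
  unfolding solution_def fst_conv snd_conv
proof (intro conjI allI)
  fix n t :: int
  show "F (fst fam (n + a) (t + b), snd fam (n - 1 + a) (t + b)) =
    (fst fam (n + a) (t + 1 + b), snd fam (n + a) (t + b))"
    using solutionD(1)[OF z, of "n + a" "t + b"] by (simp add: algebra_simps)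
  show "fst fam (n + a) (0 + b) = fst fam (n + a) b" by simp
  have *: "SX (even (n + a + (t + b))) = SX (even (n + t))" "SU (even (n + a + (t + b))) = SU (even (n + t))"
    using ab[unfolded compatible_shift_def, rule_format, of "n + t"] by (simp_all add: algebra_simps)
  show "fst fam (n + a) (t + b) \<in> SX (even (n + t))" "snd fam (n + a) (t + b) \<in> SU (even (n + t))"
    using solutionD(3,4)[OF z, of "n + a" "t + b"] unfolding * by auto
qed

lemma shift:
  assumes x: "x \<in> Xstar" and a: "compatible_shift a"
  shows "(\<lambda>n. x (n + a)) \<in> Xstar" and "U n (\<lambda>n. x (n + a)) = U (n + a) x"
proof -
  define S :: "int \<Rightarrow> (int \<Rightarrow> int \<Rightarrow> 'a) \<times> (int \<Rightarrow> int \<Rightarrow> 'b) \<Rightarrow> (int \<Rightarrow> int \<Rightarrow> 'a) \<times> (int \<Rightarrow> int \<Rightarrow> 'b)"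
    where "S a fam = ((\<lambda>n t. fst fam (n + a) t), (\<lambda>n t. snd fam (n + a) t))" for a fam
  have S: "solution (\<lambda>n. z (n + a)) (S a fam)" if "solution z fam" "compatible_shift a" for z fam a
    using solution_shift[of z fam a 0] that solutionD(2)[OF that(1)] by (simp add: S_def)
  have SS: "S a (S (- a) fam) = fam" for fam by (simp add: S_def)
  note * = Xstar_transfer[where g = "S a" and h = "S (- a)" and y = "\<lambda>n. x (n + a)", OF S[OF _ a] _ SS x]
  have S': "solution x (S (- a) fam)" if "solution (\<lambda>n. x (n + a)) fam" for fam
    using S[OF that compatible_shift_uminus[OF a]] by simp
  show 1: "(\<lambda>n. x (n + a)) \<in> Xstar" by (rule *(1)) (auto intro: S')
  have "fam_of (\<lambda>n. x (n + a)) = S a (fam_of x)" by (rule *(2)) (auto intro: S')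
  then show "U n (\<lambda>n. x (n + a)) = U (n + a) x"
    using 1 x by (simp add: U_def S_def)
qed

text \<open>Shifts preserve both \<open>Xstar\<close> and its complement, and on the complement both
  sides are \<open>undefined\<close>; the identity thus holds everywhere and not just almost
  surely.\<close>

lemma U_shift:
  assumes a: "compatible_shift a"
  shows "U n (\<lambda>n. x (n + a)) = U (n + a) x"
proof (cases "x \<in> Xstar")
  case True
  then show ?thesis by (rule shift(2)[OF _ a])
next
  case False
  have "(\<lambda>n. x (n + a)) \<notin> Xstar"
    using shift(1)[of "\<lambda>n. x (n + a)" "- a"] compatible_shift_uminus[OF a] False by auto
  with False show ?thesis by (simp add: U_def)
qed

lemmas U_shift_even = U_shift[OF compatible_shift_even]

text \<open>The family of \<open>T x\<close> is that of \<open>x\<close> shifted by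
  \<open>(1, 1)\<close>. Reflection reads it at column \<open>- n - 1\<close> and time
  \<open>-1\<close>, which is column \<open>- n\<close> and time 0 of the original family.\<close>

lemma U_reflect_T:
  assumes x: "x \<in> Xstar" and Tx: "T x \<in> Xstar"
  shows "U n (\<lambda>n. T x (- n)) = U (- n) x"
proof -
  have "solution (T x) (\<lambda>n t. fst (fam_of x) (n + 1) (t + 1), \<lambda>n t. snd (fam_of x) (n + 1) (t + 1))"
    using solution_shift[OF solution_fam_of[OF x], of 1 1] compatible_shift_even[of 2] x
    by (simp add: T_def)
  from fam_of_eqI[OF Tx this] reflection(2)[OF Tx, of n] show ?thesis
    using x by (simp add: U_def)
qed

end

section \<open>Independence in product measures\<close>

text \<open>Resampling coordinate \<open>j\<close> independently preserves the product law and almost surely does not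
  change \<open>f\<close>; this avoids showing that \<open>f\<close> is measurable with respect to the other coordinates.\<close>

lemma PiM_coordinate_independent:
  fixes M :: "'i \<Rightarrow> 'a measure"
  assumes M: "\<And>i. prob_space (M i)"
    and f: "f \<in> PiM UNIV M \<rightarrow>\<^sub>M N"
    and E: "AE x in PiM UNIV M. x \<in> E"
    and dep: "\<And>x y. x \<in> E \<Longrightarrow> y \<in> E \<Longrightarrow> (\<And>i. i \<noteq> j \<Longrightarrow> x i = y i) \<Longrightarrow> f x = f y"
  shows "distr (PiM UNIV M) (M j \<Otimes>\<^sub>M N) (\<lambda>x. (x j, f x)) = M j \<Otimes>\<^sub>M distr (PiM UNIV M) N f"
proof -
  let ?P = "PiM UNIV M" and ?w = "\<lambda>(a, x). x(j := a)"
  let ?Q = "M j \<Otimes>\<^sub>M ?P" and ?h = "\<lambda>x. (x j, f x)"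
  interpret Mj: prob_space "M j" by (rule M)
  interpret P: prob_space ?P by (rule prob_space_PiM) (rule M)
  have w [measurable]: "?w \<in> ?Q \<rightarrow>\<^sub>M ?P"
    using measurable_fun_upd[where I = UNIV and J = UNIV] by measurable
  note f[measurable]
  have resample: "distr ?Q ?P ?w = ?P"
    using distr_pair_PiM_eq_PiM[of UNIV M j] M by simp
  have AE_w: "AE p in ?Q. ?w p \<in> E"
    by (rule AE_distrD[OF w]) (unfold resample, rule E)
  \<comment> \<open>Swapping the factors turns the second marginal into a first marginal.\<close>
  have "pair_sigma_finite (M j) ?P" ..
  then have "distr ?Q ?P snd = distr (distr (?P \<Otimes>\<^sub>M M j) ?Q (\<lambda>(x, y). (y, x))) ?P snd"
    by (simp add: pair_sigma_finite.distr_pair_swap[symmetric])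
  also have "\<dots> = distr (?P \<Otimes>\<^sub>M M j) ?P fst"
    by (subst distr_distr) (auto simp: comp_def case_prod_beta)
  finally have snd: "distr ?Q ?P snd = ?P" by (simp add: Mj.distr_pair_fst)
  have AE_snd: "AE p in ?Q. snd p \<in> E"
    by (rule AE_distrD[OF measurable_snd]) (unfold snd, rule E)
  have "distr ?P (M j \<Otimes>\<^sub>M N) ?h = distr ?Q (M j \<Otimes>\<^sub>M N) (?h \<circ> ?w)"
    by (subst resample[symmetric], subst distr_distr) auto
  also have "\<dots> = distr ?Q (M j \<Otimes>\<^sub>M N) (\<lambda>(a, x). (a, f x))"
  proof (rule distr_cong_AE)
    \<comment> \<open>Almost surely the original and the resampled configuration both lie in
      \<open>E\<close>, and they differ at most at \<open>j\<close>.\<close>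
    show "AE p in ?Q. (?h \<circ> ?w) p = (case p of (a, x) \<Rightarrow> (a, f x))"
      using AE_w AE_snd by eventually_elim (auto intro: dep)
  qed auto
  also have "\<dots> = distr (M j) (M j) (\<lambda>a. a) \<Otimes>\<^sub>M distr ?P N f"
    by (rule pair_measure_distr[symmetric]) (auto intro!: prob_space_imp_sigma_finite P.prob_space_distr)
  finally show ?thesis by simp
qed

text \<open>The sets \<open>C\<close> with this property are closed under complements and countable
  disjoint unions, and rectangles form an intersection-stable generator.\<close>

lemma indep_event_pair:
  assumes "prob_space P" and D: "D \<in> sets P"
    and Y: "Y \<in> P \<rightarrow>\<^sub>M A" and Z: "Z \<in> P \<rightarrow>\<^sub>M N"
    and rect: "\<And>a b. a \<in> sets A \<Longrightarrow> b \<in> sets N \<Longrightarrow>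
      measure P (D \<inter> {x \<in> space P. Y x \<in> a \<and> Z x \<in> b}) = measure P D * measure P {x \<in> space P. Y x \<in> a \<and> Z x \<in> b}"
    and C: "C \<in> sets (A \<Otimes>\<^sub>M N)"
  shows "measure P (D \<inter> {x \<in> space P. (Y x, Z x) \<in> C}) = measure P D * measure P {x \<in> space P. (Y x, Z x) \<in> C}"
proof -
  interpret prob_space P by fact
  note [measurable] = D Y Z
  let ?G = "{a \<times> b | a b. a \<in> sets A \<and> b \<in> sets N}" and ?O = "space A \<times> space N"
  have S: "sigma_sets ?O ?G = sets (A \<Otimes>\<^sub>M N)" by (simp add: sets_pair_measure)
  have Cs: "C \<in> sigma_sets ?O ?G" using C S by simp
  have sp: "(Y x, Z x) \<in> ?O" if "x \<in> space P" for x
    using that measurable_space[OF Y] measurable_space[OF Z] by auto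
  from Int_stable_pair_measure_generator pair_measure_closed Cs show ?thesis
  proof (induction rule: sigma_sets_induct_disjoint)
    case (basic K)
    then obtain a b where "K = a \<times> b" "a \<in> sets A" "b \<in> sets N" by auto
    then show ?case using rect[of a b] by simp
  next
    case empty
    then show ?case by simp
  next
    case (compl K)
    then have [measurable]: "K \<in> sets (A \<Otimes>\<^sub>M N)" using S by simp
    let ?K = "{x \<in> space P. (Y x, Z x) \<in> K}"
    have 1: "{x \<in> space P. (Y x, Z x) \<in> ?O - K} = space P - ?K" using sp by auto
    have 2: "D \<inter> (space P - ?K) = D - (D \<inter> ?K)" using sets.sets_into_space[OF D] by auto
    have "prob (D - (D \<inter> ?K)) = prob D - prob (D \<inter> ?K)"
      by (rule finite_measure_Diff) auto
    moreover have "prob (space P - ?K) = 1 - prob ?K" by (rule prob_compl) measurable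
    moreover have "prob D - prob D * prob ?K = prob D * (1 - prob ?K)" by (simp add: right_diff_distrib)
    ultimately show ?case unfolding 1 2 compl.IH by simp
  next
    case (union K)
    then have [measurable]: "K i \<in> sets (A \<Otimes>\<^sub>M N)" for i using S by auto
    let ?K = "\<lambda>i. {x \<in> space P. (Y x, Z x) \<in> K i}"
    have disj: "disjoint_family ?K" using union.hyps(1) by (auto simp: disjoint_family_on_def)
    have 1: "{x \<in> space P. (Y x, Z x) \<in> (\<Union>i. K i)} = (\<Union>i. ?K i)"
      "D \<inter> (\<Union>i. ?K i) = (\<Union>i. D \<inter> ?K i)" by auto
    have "(\<lambda>i. prob (D \<inter> ?K i)) sums prob (\<Union>i. D \<inter> ?K i)"
      using disj by (intro finite_measure_UNION) (auto simp: disjoint_family_on_def)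
    moreover have "(\<lambda>i. prob D * prob (?K i)) sums (prob D * prob (\<Union>i. ?K i))"
      using disj by (intro sums_mult finite_measure_UNION) auto
    ultimately show ?case unfolding 1 union.IH by (rule sums_unique2)
  qed
qed

section \<open>The product law with marginals depending on parity\<close>

locale lattice_law = lattice F SX SU
  for F :: "'a \<times> 'b \<Rightarrow> 'a \<times> 'b" and SX SU +
  fixes m :: "bool \<Rightarrow> 'a measure" and A :: "'a measure" and N :: "'b measure"
  assumes prob_m: "prob_space (m e)" and sets_m: "sets (m e) = sets A"
    and spaces: "space A = UNIV" "space N = UNIV"
    and F_meas: "F \<in> A \<Otimes>\<^sub>M N \<rightarrow>\<^sub>M A \<Otimes>\<^sub>M N"
begin

definition P :: "(int \<Rightarrow> 'a) measure" where
  "P = PiM UNIV (\<lambda>n. m (even n))"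

lemma prob_space_P: "prob_space P"
  unfolding P_def by (rule prob_space_PiM) (rule prob_m)

lemma space_P: "space P = UNIV"
  using spaces sets_eq_imp_space_eq[OF sets_m] by (simp add: P_def space_PiM)

lemma measurable_coordinate [measurable]: "(\<lambda>x. x n) \<in> P \<rightarrow>\<^sub>M A"
proof -
  have "(\<lambda>x. x n) \<in> P \<rightarrow>\<^sub>M m (even n)" unfolding P_def by measurable
  then show ?thesis by (simp cong: measurable_cong_sets add: sets_m)
qed

lemma P_reindex:
  assumes "inj f" and "\<And>n. m (even (f n)) = m (even n)"
  shows "distr P P (\<lambda>x n. x (f n)) = P"
  using distr_PiM_reindex[of UNIV "\<lambda>n. m (even n)" f UNIV] assms prob_m
  by (simp add: P_def restrict_UNIV)

lemma measurable_reindex: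
  assumes "\<And>n. m (even (f n)) = m (even n)"
  shows "(\<lambda>x n. x (f n)) \<in> P \<rightarrow>\<^sub>M P"
proof -
  have "(\<lambda>x. x (f n)) \<in> P \<rightarrow>\<^sub>M m (even (f n))" for n
    unfolding P_def by measurable
  then have "(\<lambda>x. x (f n)) \<in> P \<rightarrow>\<^sub>M m (even n)" for n
    by (simp only: assms)
  then show ?thesis
    unfolding P_def by (intro measurable_PiM_single') (auto simp: sets_eq_imp_space_eq[OF sets_m] spaces)
qed

end

section \<open>Local laws, and invariance implies balance\<close>

locale lattice_invariance = lattice_law F SX SU m A N
  for F :: "'a \<times> 'b \<Rightarrow> 'a \<times> 'b" and SX SU m A N +
  assumes AE_Xstar: "AE x in P. x \<in> Xstar"
    and U_meas: "U (-1) \<in> P \<rightarrow>\<^sub>M N" "U 0 \<in> P \<rightarrow>\<^sub>M N"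
    and T_meas: "T \<in> P \<rightarrow>\<^sub>M P"
begin

lemma measurable_U [measurable]: "U n \<in> P \<rightarrow>\<^sub>M N"
proof -
  \<comment> \<open>Only even translations preserve the law, so two base columns are needed.\<close>
  obtain c a where c: "c = -1 \<or> c = 0" and a: "even a" and n: "n = c + a"
  proof (cases "even n")
    case True
    then show ?thesis using that[of 0 n] by simp
  next
    case False
    then show ?thesis using that[of "-1" "n + 1"] by simp
  qed
  have "(\<lambda>x. U c (\<lambda>k. x (k + a))) \<in> P \<rightarrow>\<^sub>M N"
    by (rule measurable_compose[OF measurable_reindex]) (use c U_meas a in auto)
  then show ?thesis by (simp add: U_shift_even[OF a] n)
qed

lemma pair_meas [measurable]: "(\<lambda>x. (x n, U k x)) \<in> P \<rightarrow>\<^sub>M A \<Otimes>\<^sub>M N"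
  by measurable

lemma F_pair_meas [measurable]: "(\<lambda>x. F (x n, U k x)) \<in> P \<rightarrow>\<^sub>M A \<Otimes>\<^sub>M N"
  by (rule measurable_compose[OF pair_meas F_meas])

text \<open>By causality \<open>U k\<close> does not change on \<open>Xstar\<close> when a column to
  the right of \<open>k\<close> is altered.\<close>

lemma pair_independent:
  assumes "n > k"
  shows "distr P (m (even n) \<Otimes>\<^sub>M N) (\<lambda>x. (x n, U k x)) = m (even n) \<Otimes>\<^sub>M distr P N (U k)"
  unfolding P_def
proof (rule PiM_coordinate_independent[where E = Xstar])
  show "U k x = U k y" if "x \<in> Xstar" "y \<in> Xstar" "\<And>i. i \<noteq> n \<Longrightarrow> x i = y i" for x y
    by (rule causality) (use that assms in auto)
qed (use prob_m AE_Xstar measurable_U[of k] in \<open>simp_all only: P_def\<close>)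

text \<open>The law of the pair that enters \<open>F\<close> at column \<open>n\<close> and time 0.
  Column 0 yields \<mu> and \<nu>, column 1 their tilde versions in type II, so balance becomes a
  relation between neighbouring columns.\<close>

definition local_law :: "int \<Rightarrow> ('a \<times> 'b) measure" where
  "local_law n = distr P (A \<Otimes>\<^sub>M N) (\<lambda>x. (x n, U (n - 1) x))"

lemma local_law_eq: "local_law n = m (even n) \<Otimes>\<^sub>M distr P N (U (n - 1))"
  unfolding local_law_def pair_independent[of "n - 1" n, simplified, symmetric]
  by (rule distr_cong) (simp_all add: sets_m cong: sets_pair_measure_cong)

lemma local_law_shift:
  assumes "even a"
  shows "local_law (n + a) = local_law n"
proof -
  let ?S = "\<lambda>x n. x (n + a)"
  have S: "distr P P ?S = P" "?S \<in> P \<rightarrow>\<^sub>M P"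
    using assms by (auto intro!: P_reindex measurable_reindex simp: inj_def)
  have "local_law n = distr (distr P P ?S) (A \<Otimes>\<^sub>M N) (\<lambda>x. (x n, U (n - 1) x))"
    by (simp only: local_law_def S)
  also have "\<dots> = distr P (A \<Otimes>\<^sub>M N) (\<lambda>x. (x (n + a), U (n - 1 + a) x))"
    by (subst distr_distr[OF pair_meas S(2)]) (simp only: comp_def U_shift_even[OF assms])
  finally show ?thesis by (simp add: local_law_def algebra_simps)
qed

text \<open>Even columns follow by translation. For odd ones, apply \<open>F\<close> to both sides
  of the hypothesis and use that it is an involution.\<close>

lemma local_balance_all:
  assumes "distr (local_law 0) (A \<Otimes>\<^sub>M N) F = local_law 1"
  shows "distr (local_law n) (A \<Otimes>\<^sub>M N) F = local_law (n + 1)"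
proof (cases "even n")
  case True
  then show ?thesis using assms local_law_shift[of n 0] local_law_shift[of n 1] by (simp add: add.commute)
next
  case False
  have "distr (local_law 1) (A \<Otimes>\<^sub>M N) F = distr (local_law 0) (A \<Otimes>\<^sub>M N) (\<lambda>p. F (F p))"
    unfolding assms[symmetric]
    by (subst distr_distr[OF F_meas]) (simp_all add: F_meas comp_def local_law_def)
  also have "\<dots> = local_law 0"
    by (simp add: involution distr_id2 local_law_def)
  finally show ?thesis using False local_law_shift[of "n - 1" 1] local_law_shift[of "n + 1" 0] by simp
qed

theorem invariance_imp_balance:
  assumes inv: "distr P P T = P"
  shows "distr (local_law 0) (A \<Otimes>\<^sub>M N) F = local_law 1"
proof -
  let ?R = "\<lambda>x n. x (- n)"
  let ?g = "\<lambda>x. (x 1, U 0 x)"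
  have R: "distr P P ?R = P" "?R \<in> P \<rightarrow>\<^sub>M P"
    by (auto intro!: P_reindex measurable_reindex simp: inj_def)
  \<comment> \<open>Invariance transports the full-measure property of \<open>Xstar\<close> from
    \<open>x\<close> to \<open>T x\<close>.\<close>
  have AE_T: "AE x in P. T x \<in> Xstar"
    by (rule AE_distrD[OF T_meas]) (unfold inv, rule AE_Xstar)
  have "local_law 1 = distr (distr (distr P P T) P ?R) (A \<Otimes>\<^sub>M N) ?g"
    by (simp add: inv R(1) local_law_def)
  also have "\<dots> = distr P (A \<Otimes>\<^sub>M N) (\<lambda>x. ?g (?R (T x)))"
    using T_meas R(2) pair_meas by (simp add: distr_distr comp_def)
  also have "\<dots> = distr P (A \<Otimes>\<^sub>M N) (\<lambda>x. F (x 0, U (-1) x))"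
  proof (rule distr_cong_AE)
    show "AE x in P. ?g (?R (T x)) = F (x 0, U (-1) x)"
      using AE_Xstar AE_T
    proof eventually_elim
      case (elim x)
      \<comment> \<open>The reflected configuration has \<open>T x (-1)\<close> at column 1, the
        first output of \<open>F\<close> at column 0, and its carrier at column 0 is
        \<open>U 0 x\<close>, the second output.\<close>
      then show ?case using one_step[of x 0] U_reflect_T[of x 0] by simp
    qed
    show "(\<lambda>x. ?g (?R (T x))) \<in> P \<rightarrow>\<^sub>M A \<Otimes>\<^sub>M N"
      by (rule measurable_compose[OF measurable_compose[OF T_meas R(2)] pair_meas])
  qed auto
  also have "\<dots> = distr (local_law 0) (A \<Otimes>\<^sub>M N) F"
    using F_meas pair_meas by (simp add: local_law_def distr_distr comp_def)
  finally show ?thesis ..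
qed

section \<open>Balance implies invariance\<close>

text \<open>On \<open>Xstar\<close> this is \<open>T x n\<close>, but unlike \<open>T\<close> its causal dependence on \<open>x\<close> is explicit.\<close>

definition Y :: "int \<Rightarrow> (int \<Rightarrow> 'a) \<Rightarrow> 'a" where
  "Y n x = fst (F (x (n + 1), U n x))"

lemma Y_meas [measurable]: "Y n \<in> P \<rightarrow>\<^sub>M A"
  unfolding Y_def by (rule measurable_compose[OF F_pair_meas measurable_fst])

lemma Y_causal:
  assumes "x \<in> Xstar" "y \<in> Xstar" "\<And>i. i \<le> n + 1 \<Longrightarrow> x i = y i"
  shows "Y n x = Y n y"
  using causality[of x y n] assms by (simp add: Y_def)

text \<open>An event is treated as a \<open>bool\<close>-valued random variable, which reduces the
  claim to \<open>PiM_coordinate_independent\<close>.\<close>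

lemma fresh_coordinate:
  assumes G [measurable]: "Measurable.pred P G"
    and causal: "\<And>x y. x \<in> Xstar \<Longrightarrow> y \<in> Xstar \<Longrightarrow> (\<And>i. i \<noteq> n \<Longrightarrow> x i = y i) \<Longrightarrow> G x = G y"
    and a [measurable]: "a \<in> sets A"
  shows "measure P {x. x n \<in> a \<and> G x} = measure (m (even n)) a * measure P {x. G x}"
proof -
  let ?C = "count_space UNIV :: bool measure"
  let ?M = "\<lambda>n. m (even n)"
  interpret P: prob_space P by (rule prob_space_P)
  interpret D: prob_space "distr P ?C G" by (rule P.prob_space_distr[OF G])
  have eq: "distr P (?M n \<Otimes>\<^sub>M ?C) (\<lambda>x. (x n, G x)) = ?M n \<Otimes>\<^sub>M distr P ?C G"
    unfolding P_def
    by (rule PiM_coordinate_independent[OF prob_m G[unfolded P_def] AE_Xstar[unfolded P_def] causal])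
  have a': "a \<in> sets (?M n)" using sets_m a by simp
  have [measurable]: "(\<lambda>x. x n) \<in> P \<rightarrow>\<^sub>M ?M n" unfolding P_def by measurable
  have "measure P {x. x n \<in> a \<and> G x} = measure (distr P (?M n \<Otimes>\<^sub>M ?C) (\<lambda>x. (x n, G x))) (a \<times> {True})"
    using a' by (subst measure_distr) (auto simp: space_P intro!: arg_cong[where f = "measure P"])
  also have "\<dots> = measure (?M n) a * measure (distr P ?C G) {True}"
    unfolding eq using a' by (simp add: measure_def D.emeasure_pair_measure_Times enn2real_mult)
  also have "measure (distr P ?C G) {True} = measure P {x. G x}"
    by (subst measure_distr) (auto simp: space_P intro!: arg_cong[where f = "measure P"])
  finally show ?thesis .
qed

lemma measure_local_law:
  "c \<in> sets (A \<Otimes>\<^sub>M N) \<Longrightarrow> measure (local_law n) c = measure P {x. (x n, U (n - 1) x) \<in> c}"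
  unfolding local_law_def
  by (subst measure_distr) (auto simp: space_P intro!: arg_cong[where f = "measure P"])

text \<open>Keeping the current carrier in the event makes the induction work. The fresh site
  \<open>x (n + 1)\<close> is independent of the past outputs together with \<open>U n\<close>, so
  the past is independent of the whole input pair and hence of \<open>(Y n, U (n + 1))\<close>. By
  balance that pair has the law of \<open>(x (n + 2), U (n + 1))\<close>, which is again a
  product.\<close>

lemma balance_columns:
  assumes bal: "distr (local_law 0) (A \<Otimes>\<^sub>M N) F = local_law 1"
    and a: "\<And>j. a j \<in> sets A" and b: "b \<in> sets N"
  shows "measure P {x. (\<forall>j\<in>{k..<k + int l}. Y j x \<in> a j) \<and> U (k + int l) x \<in> b} =
    (\<Prod>j\<in>{k..<k + int l}. measure (m (even j)) (a j)) * measure P {x. U (k + int l) x \<in> b}"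
  using b
proof (induction l arbitrary: b)
  case 0
  then show ?case by simp
next
  case (Suc l)
  interpret P: prob_space P by (rule prob_space_P)
  note a[measurable] Suc.prems[measurable]
  define n where "n = k + int l"
  define D where "D x \<longleftrightarrow> (\<forall>j\<in>{k..<n}. Y j x \<in> a j)" for x
  define c where "c = (\<Prod>j\<in>{k..<n}. measure (m (even j)) (a j))"
  have D_meas [measurable]: "Measurable.pred P D" unfolding D_def by measurable
  have IH: "measure P {x. D x \<and> U n x \<in> b} = c * measure P {x. U n x \<in> b}" if "b \<in> sets N" for b
    using Suc.IH[OF that] by (simp add: D_def n_def c_def)
  have "UNIV \<in> sets N" using sets.top[of N] spaces by simp
  \<comment> \<open>Taking the whole space for the carrier event identifies \<open>c\<close> as the
    probability of \<open>D\<close>.\<close>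
  from IH[OF this] have c: "measure P {x. D x} = c" using P.prob_space by (simp add: space_P)
  have D_sets: "{x. D x} \<in> sets P"
    using D_meas by (simp add: pred_def space_P)
  \<comment> \<open>The event that the output pair of column \<open>n + 1\<close> lies in
    \<open>a n \<times> b\<close>, expressed through the input pair; it is in general not a
    rectangle.\<close>
  let ?C = "F -` (a n \<times> b) \<inter> space (A \<Otimes>\<^sub>M N)"
  have C: "?C \<in> sets (A \<Otimes>\<^sub>M N)" by (rule measurable_sets[OF F_meas]) measurable
  have fresh: "measure P {x. x (n + 1) \<in> a' \<and> U n x \<in> b'} =
      measure (m (even (n + 1))) a' * measure P {x. U n x \<in> b'}"
    if [measurable]: "a' \<in> sets A" "b' \<in> sets N" for a' b' n
    by (rule fresh_coordinate) (measurable, auto dest: causality[of _ _ n])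
  have freshD: "measure P {x. x (n + 1) \<in> a' \<and> D x \<and> U n x \<in> b'} =
      measure (m (even (n + 1))) a' * measure P {x. D x \<and> U n x \<in> b'}"
    if [measurable]: "a' \<in> sets A" "b' \<in> sets N" for a' b'
  proof (rule fresh_coordinate)
    fix x y assume xy: "x \<in> Xstar" "y \<in> Xstar" "\<And>i. i \<noteq> n + 1 \<Longrightarrow> x i = y i"
    have "Y j x = Y j y" if "j < n" for j
      using xy that by (intro Y_causal) auto
    moreover have "U n x = U n y" using xy by (intro causality) auto
    ultimately show "(D x \<and> U n x \<in> b') = (D y \<and> U n y \<in> b')" by (simp add: D_def)
  qed measurable
  have "measure P {x. (\<forall>j\<in>{k..<k + int (Suc l)}. Y j x \<in> a j) \<and> U (k + int (Suc l)) x \<in> b} =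
    measure P {x. D x \<and> (x (n + 1), U n x) \<in> ?C}"
  proof (rule P.finite_measure_eq_AE)
    have ball: "(\<forall>j\<in>{k..<k + int (Suc l)}. Y j x \<in> a j) \<longleftrightarrow> D x \<and> Y n x \<in> a n" for x
    proof -
      have "{k..<k + int (Suc l)} = insert n {k..<n}" by (auto simp: n_def)
      then show ?thesis by (auto simp: D_def)
    qed
    show "AE x in P. (x \<in> {x. (\<forall>j\<in>{k..<k + int (Suc l)}. Y j x \<in> a j) \<and> U (k + int (Suc l)) x \<in> b}) =
      (x \<in> {x. D x \<and> (x (n + 1), U n x) \<in> ?C})"
      using AE_Xstar
    proof eventually_elim
      case (elim x)
      have U: "U (k + int (Suc l)) x = snd (F (x (n + 1), U n x))"
        using one_step[OF elim, of "n + 1"] by (simp add: n_def algebra_simps)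
      show ?case unfolding mem_Collect_eq ball U
        by (cases "F (x (n + 1), U n x)") (auto simp: Y_def space_pair_measure spaces)
    qed
    have "Measurable.pred P (\<lambda>x. (\<forall>j\<in>{k..<k + int (Suc l)}. Y j x \<in> a j) \<and> U (k + int (Suc l)) x \<in> b)"
      by measurable
    then show "{x. (\<forall>j\<in>{k..<k + int (Suc l)}. Y j x \<in> a j) \<and> U (k + int (Suc l)) x \<in> b} \<in> sets P"
      by (simp add: pred_def space_P)
    note C[measurable]
    have "Measurable.pred P (\<lambda>x. D x \<and> (x (n + 1), U n x) \<in> ?C)"
      by measurable
    then show "{x. D x \<and> (x (n + 1), U n x) \<in> ?C} \<in> sets P"
      by (simp add: pred_def space_P)
  qed
  also have "\<dots> = c * measure P {x. (x (n + 1), U n x) \<in> ?C}"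
  proof -
    \<comment> \<open>For rectangles, \<open>freshD\<close> and \<open>fresh\<close> split off the
      new site and \<open>IH\<close> separates \<open>D\<close> from the carrier;
      \<open>indep_event_pair\<close> then reaches \<open>?C\<close>.\<close>
    have "measure P ({x. D x} \<inter> {x \<in> space P. x (n + 1) \<in> a' \<and> U n x \<in> b'}) =
        measure P {x. D x} * measure P {x \<in> space P. x (n + 1) \<in> a' \<and> U n x \<in> b'}"
      if "a' \<in> sets A" "b' \<in> sets N" for a' b'
    proof -
      have "{x. D x} \<inter> {x \<in> space P. x (n + 1) \<in> a' \<and> U n x \<in> b'} = {x. x (n + 1) \<in> a' \<and> D x \<and> U n x \<in> b'}"
        by (auto simp: space_P)
      then show ?thesis using freshD[OF that] fresh[OF that, of n] IH[OF that(2)] by (simp add: c space_P)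
    qed
    from indep_event_pair[OF prob_space_P D_sets measurable_coordinate[of "n + 1"] measurable_U[of n] this C]
    show ?thesis by (simp only: c space_P Int_def mem_Collect_eq) simp
  qed
  also have "measure P {x. (x (n + 1), U n x) \<in> ?C} = measure (local_law (n + 1)) ?C"
    using measure_local_law[OF C, of "n + 1"] by simp
  also have "\<dots> = measure (distr (local_law (n + 1)) (A \<Otimes>\<^sub>M N) F) (a n \<times> b)"
    by (subst measure_distr) (auto simp: local_law_def F_meas)
  also have "\<dots> = measure P {x. x (n + 1 + 1) \<in> a n \<and> U (n + 1) x \<in> b}"
    unfolding local_balance_all[OF bal] by (subst measure_local_law) (auto simp: algebra_simps)
  \<comment> \<open>The site is now \<open>n + 2\<close>, which has the parity of \<open>n\<close>,
    and it is fresh for \<open>U (n + 1)\<close>.\<close>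
  also have "\<dots> = measure (m (even n)) (a n) * measure P {x. U (n + 1) x \<in> b}"
    using fresh[of "a n" b "n + 1"] Suc.prems a by simp
  finally have *: "measure P {x. (\<forall>j\<in>{k..<k + int (Suc l)}. Y j x \<in> a j) \<and> U (k + int (Suc l)) x \<in> b} =
    c * (measure (m (even n)) (a n) * measure P {x. U (n + 1) x \<in> b})" .
  have "{k..<k + int (Suc l)} = insert n {k..<n}" by (auto simp: n_def)
  then have "(\<Prod>j\<in>{k..<k + int (Suc l)}. measure (m (even j)) (a j)) = measure (m (even n)) (a n) * c"
    by (simp add: c_def)
  with * show ?case by (simp add: n_def algebra_simps)
qed

theorem balance_imp_invariance:
  assumes bal: "distr (local_law 0) (A \<Otimes>\<^sub>M N) F = local_law 1"
  shows "distr P P T = P"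
  unfolding P_def
proof (rule measure_eqI_PiM_infinite)
  let ?M = "\<lambda>n::int. m (even n)"
  interpret P: prob_space P by (rule prob_space_P)
  fix a :: "int \<Rightarrow> 'a set" and J :: "int set"
  assume J: "finite J" and aJ: "\<And>i. i \<in> J \<Longrightarrow> a i \<in> sets (?M i)"
  \<comment> \<open>The column induction needs an interval; sites of it outside \<open>J\<close>
    receive the trivial constraint in \<open>a'\<close>.\<close>
  obtain k h where kh: "J \<subseteq> {k..<h}" "k \<le> h"
  proof (cases "J = {}")
    case True
    then show ?thesis using that[of 0 0] by simp
  next
    case False
    show ?thesis
    proof (rule that[of "Min J" "Max J + 1"])
      show "J \<subseteq> {Min J..<Max J + 1}" using J by (auto simp: zle_add1_eq_le)
      show "Min J \<le> Max J + 1" using Min_le[OF J Max_in[OF J False]] by simp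
    qed
  qed
  define l where "l = nat (h - k)"
  have h: "h = k + int l" using kh by (simp add: l_def)
  define a' where "a' i = (if i \<in> J then a i else UNIV)" for i
  have UNIV_A: "UNIV \<in> sets A" "UNIV \<in> sets N" using sets.top[of A] sets.top[of N] spaces by simp_all
  then have a' [measurable]: "a' i \<in> sets A" for i using aJ sets_m by (auto simp: a'_def)
  let ?c = "{x. \<forall>j\<in>{k..<h}. x j \<in> a' j}"
  have spM: "space (?M n) = UNIV" for n
    using sets_eq_imp_space_eq[OF sets_m] spaces by simp
  have "prod_emb UNIV ?M J (Pi\<^sub>E J a) = {x. \<forall>j\<in>J. x j \<in> a j}"
    by (auto simp: prod_emb_def spM PiE_iff space_PiM)
  also have "\<dots> = ?c" using kh by (auto simp: a'_def)
  finally have emb: "prod_emb UNIV ?M J (Pi\<^sub>E J a) = ?c" .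
  have emb': "prod_emb UNIV ?M {k..<h} (Pi\<^sub>E {k..<h} a') = ?c"
    by (auto simp: prod_emb_def spM PiE_iff space_PiM)
  have "Measurable.pred P (\<lambda>x. \<forall>j\<in>{k..<h}. x j \<in> a' j)" by measurable
  then have c_sets: "?c \<in> sets P" by (simp add: pred_def space_P)
  have "measure P ?c = measure P (prod_emb UNIV ?M {k..<h} (Pi\<^sub>E {k..<h} a'))" by (simp add: emb')
  also have "\<dots> = (\<Prod>j\<in>{k..<h}. measure (?M j) (a' j))"
  proof -
    interpret M: product_prob_space ?M UNIV
      by (intro product_prob_spaceI prob_m)
    show ?thesis unfolding P_def by (rule M.measure_PiM_emb) (use a' sets_m in auto)
  qed
  finally have 1: "measure P ?c = (\<Prod>j\<in>{k..<h}. measure (?M j) (a' j))" .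
  have "measure (distr P P T) ?c = measure P (T -` ?c)"
    by (subst measure_distr[OF T_meas c_sets]) (simp add: space_P)
  also have "\<dots> = measure P {x. (\<forall>j\<in>{k..<k + int l}. Y j x \<in> a' j) \<and> U (k + int l) x \<in> UNIV}"
  proof (rule P.finite_measure_eq_AE)
    show "AE x in P. (x \<in> T -` ?c) =
        (x \<in> {x. (\<forall>j\<in>{k..<k + int l}. Y j x \<in> a' j) \<and> U (k + int l) x \<in> UNIV})"
      using AE_Xstar by eventually_elim (simp add: T_eq Y_def h)
    show "T -` ?c \<in> sets P" using measurable_sets[OF T_meas c_sets] by (simp add: space_P)
    have "Measurable.pred P (\<lambda>x. (\<forall>j\<in>{k..<k + int l}. Y j x \<in> a' j))" by measurable
    then show "{x. (\<forall>j\<in>{k..<k + int l}. Y j x \<in> a' j) \<and> U (k + int l) x \<in> UNIV} \<in> sets P"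
      by (simp add: pred_def space_P)
  qed
  also have "\<dots> = (\<Prod>j\<in>{k..<h}. measure (?M j) (a' j))"
    using balance_columns[OF bal a' UNIV_A(2), of k l] P.prob_space by (simp add: h space_P)
  finally have "measure (distr P P T) ?c = measure P ?c" using 1 by simp
  moreover have "prob_space (distr P P T)" by (rule P.prob_space_distr[OF T_meas])
  ultimately have "emeasure (distr P P T) ?c = emeasure P ?c"
    by (simp add: P.emeasure_eq_measure finite_measure.emeasure_eq_measure prob_space.finite_measure)
  then show "emeasure (distr (Pi\<^sub>M UNIV ?M) (Pi\<^sub>M UNIV ?M) T) (prod_emb UNIV ?M J (Pi\<^sub>E J a)) =
      emeasure (Pi\<^sub>M UNIV ?M) (prod_emb UNIV ?M J (Pi\<^sub>E J a))"
    unfolding emb by (simp add: P_def)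
next
  interpret P: prob_space P by (rule prob_space_P)
  show "finite_measure (distr (Pi\<^sub>M UNIV (\<lambda>n. m (even n))) (Pi\<^sub>M UNIV (\<lambda>n. m (even n))) T)"
    using P.finite_measure_distr[OF T_meas] by (simp add: P_def)
qed simp_all

lemma balance_iff_invariance:
  "distr P P T = P \<longleftrightarrow> distr (local_law 0) (A \<Otimes>\<^sub>M N) F = local_law 1"
  using invariance_imp_balance balance_imp_invariance by blast

end

section \<open>The type I model\<close>

theorem type_I_invariance_iff_balance:
  fixes F :: "'x::polish_space \<times> 'u::polish_space \<Rightarrow> 'x \<times> 'u" and mu :: "'x measure"
  defines "MZ \<equiv> PiM (UNIV :: int set) (\<lambda>_. mu)"
  defines "nu \<equiv> distr MZ borel (U1 F (-1))"
  assumes invol: "\<And>p. F (F p) = p" and F: "F \<in> borel \<rightarrow>\<^sub>M borel"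
    and mu: "prob_space mu" "sets mu = sets borel"
    and Xstar1: "emeasure MZ (Xstar1 F) = 1"
    and U1: "U1 F (-1) \<in> MZ \<rightarrow>\<^sub>M borel" and T1: "T1 F \<in> MZ \<rightarrow>\<^sub>M MZ"
  shows "distr MZ MZ (T1 F) = MZ \<longleftrightarrow> distr (mu \<Otimes>\<^sub>M nu) (mu \<Otimes>\<^sub>M nu) F = mu \<Otimes>\<^sub>M nu"
proof -
  interpret L: lattice_law F "\<lambda>_. UNIV" "\<lambda>_. UNIV" "\<lambda>_. mu" borel borel
  proof (intro lattice_law.intro lattice.intro lattice_law_axioms.intro)
    show "F \<in> borel \<Otimes>\<^sub>M borel \<rightarrow>\<^sub>M borel \<Otimes>\<^sub>M borel" using F by (simp only: borel_prod)
  qed (simp_all add: invol mu)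
  have P: "L.P = MZ" by (simp add: L.P_def MZ_def)
  have sol: "L.solution = sol1 F" by (intro ext) (simp add: L.solution_def sol1_def)
  have Xs: "L.Xstar = Xstar1 F" by (simp add: L.Xstar_def Xstar1_def sol)
  have U: "L.U n = U1 F n" for n by (intro ext) (simp add: L.U_def U1_def L.fam_of_def sol Xs)
  let ?S = "\<lambda>x n. x (n + 1)" and ?S' = "\<lambda>x n. x (n - 1)"
  have T: "L.T x = (if x \<in> Xstar1 F then ?S (T1 F x) else undefined)" for x
    by (simp add: L.T_def T1_def L.fam_of_def sol Xs)
  \<comment> \<open>Sets that are not measurable get \<open>emeasure\<close> 0, so the value 1
    forces measurability.\<close>
  have X_sets: "Xstar1 F \<in> sets MZ"
    using Xstar1 emeasure_notin_sets[of "Xstar1 F" MZ] by fastforce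
  interpret MZ: prob_space MZ using L.prob_space_P by (simp add: P)
  have AE: "AE x in MZ. x \<in> Xstar1 F"
    using MZ.AE_in_set_eq_1[OF X_sets] Xstar1 by (simp add: MZ.emeasure_eq_measure)
  have S: "?S \<in> MZ \<rightarrow>\<^sub>M MZ" "distr MZ MZ ?S = MZ" and S': "?S' \<in> MZ \<rightarrow>\<^sub>M MZ" "distr MZ MZ ?S' = MZ"
    using L.measurable_reindex[of "\<lambda>n. n + 1"] L.measurable_reindex[of "\<lambda>n. n - 1"]
      L.P_reindex[of "\<lambda>n. n + 1"] L.P_reindex[of "\<lambda>n. n - 1"] by (simp_all add: P inj_def)
  have ST: "(\<lambda>x. ?S (T1 F x)) \<in> MZ \<rightarrow>\<^sub>M MZ" by (rule measurable_compose[OF T1 S(1)])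
  \<comment> \<open>With constant typing the unit shift is compatible, so the carrier at column 0 is
    the one at column -1 of a shifted configuration.\<close>
  have U0: "U1 F 0 = (\<lambda>x. U1 F (-1) (?S x))"
    using L.U_shift[of 1 "-1"] by (intro ext) (simp add: L.compatible_shift_def U)
  interpret I: lattice_invariance F "\<lambda>_. UNIV" "\<lambda>_. UNIV" "\<lambda>_. mu" borel borel
  proof
    show "AE x in L.P. x \<in> L.Xstar" using AE by (simp only: P Xs)
    show "L.U (-1) \<in> L.P \<rightarrow>\<^sub>M borel" using U1 by (simp add: U P)
    show "L.U 0 \<in> L.P \<rightarrow>\<^sub>M borel"
      unfolding U P U0 by (rule measurable_compose[OF S(1) U1])
    have "(\<lambda>x. if x \<in> Xstar1 F then ?S (T1 F x) else undefined) \<in> MZ \<rightarrow>\<^sub>M MZ"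
      using ST X_sets by (intro measurable_If_set) (auto simp: L.space_P[unfolded P])
    then show "L.T \<in> L.P \<rightarrow>\<^sub>M L.P" by (simp add: T[abs_def] P)
  qed
  have "distr MZ MZ L.T = distr MZ MZ (\<lambda>x. ?S (T1 F x))"
  proof (rule distr_cong_AE)
    show "AE x in MZ. L.T x = ?S (T1 F x)" using AE by eventually_elim (simp add: T)
  qed (use ST I.T_meas in \<open>simp_all add: P\<close>)
  also have "\<dots> = distr (distr MZ MZ (T1 F)) MZ ?S"
    by (subst distr_distr[OF S(1) T1]) (simp add: comp_def)
  finally have distr_T: "distr MZ MZ L.T = distr (distr MZ MZ (T1 F)) MZ ?S" .
  \<comment> \<open>Shifting back recovers the law of \<open>T1 F x\<close>; as both shifts fix
    \<open>MZ\<close>, the two notions of invariance coincide.\<close>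
  have "distr (distr (distr MZ MZ (T1 F)) MZ ?S) MZ ?S' = distr (distr MZ MZ (T1 F)) MZ (\<lambda>x. x)"
    using S(1) S'(1) by (subst distr_distr) (simp_all add: comp_def cong: measurable_cong_sets)
  also have "\<dots> = distr MZ MZ (T1 F)" by (simp add: distr_id2)
  finally have "distr MZ MZ (T1 F) = MZ \<longleftrightarrow> distr MZ MZ L.T = MZ"
    unfolding distr_T using S(2) S'(2) by metis
  also have "\<dots> \<longleftrightarrow> distr (I.local_law 0) (borel \<Otimes>\<^sub>M borel) F = I.local_law 1"
    using I.balance_iff_invariance by (simp add: P)
  also have "I.local_law 0 = mu \<Otimes>\<^sub>M nu" by (simp add: I.local_law_eq nu_def U P)
  also have "I.local_law 1 = mu \<Otimes>\<^sub>M nu"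
  proof -
    have "distr MZ borel (U1 F 0) = distr (distr MZ MZ ?S) borel (U1 F (-1))"
      unfolding U0 by (subst distr_distr[OF U1 S(1)]) (simp add: comp_def)
    then show ?thesis by (simp add: I.local_law_eq nu_def U P S(2))
  qed
  also have "distr (mu \<Otimes>\<^sub>M nu) (borel \<Otimes>\<^sub>M borel) F = distr (mu \<Otimes>\<^sub>M nu) (mu \<Otimes>\<^sub>M nu) F"
    by (rule distr_cong) (simp_all add: mu nu_def cong: sets_pair_measure_cong)
  finally show ?thesis .
qed

section \<open>Measurability on sums and the gluing of the type II map\<close>

lemma sets_sum_borelI:
  fixes C :: "('a::topological_space + 'b::topological_space) set"
  assumes "Inl -` C \<in> sets borel" and "Inr -` C \<in> sets borel"
  shows "C \<in> sets sum_borel"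
proof -
  have "C = Inl ` (Inl -` C) \<union> Inr ` (Inr -` C)"
  proof (intro equalityI subsetI)
    fix x assume "x \<in> C"
    then show "x \<in> Inl ` (Inl -` C) \<union> Inr ` (Inr -` C)" by (cases x) auto
  qed auto
  moreover have "Inl ` (Inl -` C) \<in> sets sum_borel" "Inr ` (Inr -` C) \<in> sets sum_borel"
    using assms by (auto simp: sum_borel_def)
  ultimately show ?thesis by (metis sets.Un)
qed

lemma space_sum_borel [simp]: "space sum_borel = UNIV"
  by (simp add: sum_borel_def)

lemma measurable_Inl_sum_borel [measurable]: "Inl \<in> borel \<rightarrow>\<^sub>M sum_borel"
  and measurable_Inr_sum_borel [measurable]: "Inr \<in> borel \<rightarrow>\<^sub>M sum_borel"
  unfolding sum_borel_def
  by (auto intro!: measurable_measure_of simp: inj_vimage_image_eq vimage_def image_iff)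

lemma measurable_case_sum:
  assumes "f \<in> borel \<rightarrow>\<^sub>M M" and "g \<in> borel \<rightarrow>\<^sub>M M"
  shows "case_sum f g \<in> sum_borel \<rightarrow>\<^sub>M M"
proof (rule measurableI)
  show "case_sum f g x \<in> space M" for x
    using measurable_space[OF assms(1)] measurable_space[OF assms(2)] by (cases x) auto
  show "case_sum f g -` C \<inter> space sum_borel \<in> sets sum_borel" if "C \<in> sets M" for C
    using measurable_sets[OF assms(1) that] measurable_sets[OF assms(2) that]
    by (intro sets_sum_borelI) (auto simp: vimage_def)
qed

lemma range_Inl_sum_borel [measurable]: "range Inl \<in> sets sum_borel"
  and range_Inr_sum_borel [measurable]: "range Inr \<in> sets sum_borel"
  by (auto intro!: sets_sum_borelI simp: vimage_def image_def)

text \<open>The default on the other summand is constant, which keeps these left inverses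
  measurable.\<close>

definition from_Inl :: "'a + 'b \<Rightarrow> 'a" where "from_Inl = case_sum (\<lambda>a. a) (\<lambda>_. undefined)"
definition from_Inr :: "'a + 'b \<Rightarrow> 'b" where "from_Inr = case_sum (\<lambda>_. undefined) (\<lambda>b. b)"

lemma from_simps [simp]: "from_Inl (Inl a) = a" "from_Inr (Inr b) = b"
  by (simp_all add: from_Inl_def from_Inr_def)

lemma measurable_from [measurable]: "from_Inl \<in> sum_borel \<rightarrow>\<^sub>M borel" "from_Inr \<in> sum_borel \<rightarrow>\<^sub>M borel"
  unfolding from_Inl_def from_Inr_def by (auto intro!: measurable_case_sum)

text \<open>\<open>F\<^sub>*\<close> and its inverse become a single involution of the sum types; on ill-typed pairs it is the
  identity, and such pairs are excluded from solutions by the parity condition \<open>side\<close>.\<close>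

definition glued :: "('x \<times> 'u \<Rightarrow> 'xt \<times> 'ut) \<Rightarrow> ('x + 'xt) \<times> ('ut + 'u) \<Rightarrow> ('x + 'xt) \<times> ('ut + 'u)" where
  "glued Fs p =
    (if fst p \<in> range Inl \<and> snd p \<in> range Inr then map_prod Inr Inl (Fs (from_Inl (fst p), from_Inr (snd p)))
     else if fst p \<in> range Inr \<and> snd p \<in> range Inl then map_prod Inl Inr (inv Fs (from_Inr (fst p), from_Inl (snd p)))
     else p)"

lemma glued_simps [simp]:
  "glued Fs (Inl a, Inr b) = map_prod Inr Inl (Fs (a, b))"
  "glued Fs (Inr a', Inl b') = map_prod Inl Inr (inv Fs (a', b'))"
  "glued Fs (Inl a, Inl b') = (Inl a, Inl b')"
  "glued Fs (Inr a', Inr b) = (Inr a', Inr b)"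
  by (auto simp: glued_def)

lemma glued_involution:
  assumes "bij Fs"
  shows "glued Fs (glued Fs p) = p"
proof -
  obtain v w where p: "p = (v, w)" by (cases p)
  have 1: "inv Fs (Fs q) = q" "Fs (inv Fs q') = q'" for q q'
    using assms by (simp_all add: bij_is_inj bij_is_surj surj_f_inv_f)
  have 2: "glued Fs (map_prod Inl Inr q) = map_prod Inr Inl (Fs q)"
    "glued Fs (map_prod Inr Inl q') = map_prod Inl Inr (inv Fs q')" for q q'
    by (cases q, simp, cases q', simp)
  show ?thesis unfolding p by (cases v; cases w) (simp_all add: 1 2)
qed

lemma measurable_glued:
  fixes Fs :: "'x0::polish_space \<times> 'u0::polish_space \<Rightarrow> 'xt::polish_space \<times> 'ut::polish_space"
  assumes "Fs \<in> borel \<rightarrow>\<^sub>M borel" and "inv Fs \<in> borel \<rightarrow>\<^sub>M borel"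
  shows "glued Fs \<in> sum_borel \<Otimes>\<^sub>M sum_borel \<rightarrow>\<^sub>M sum_borel \<Otimes>\<^sub>M sum_borel"
proof -
  have [measurable]: "Fs \<in> borel \<Otimes>\<^sub>M borel \<rightarrow>\<^sub>M borel \<Otimes>\<^sub>M borel"
    "inv Fs \<in> borel \<Otimes>\<^sub>M borel \<rightarrow>\<^sub>M borel \<Otimes>\<^sub>M borel"
    using assms by (simp_all add: borel_prod)
  show ?thesis unfolding glued_def[abs_def] map_prod_def case_prod_beta by measurable
qed

text \<open>One definition serves sites and carriers, because the carrier sum lists the tilde space
  first: at even \<open>n + t\<close> both variables are in the left summand.\<close>

definition side :: "bool \<Rightarrow> ('a + 'b) set" where
  "side e = (if e then range Inl else range Inr)"

lemma sol2_iff_glued: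
  "sol2 Fs x fam \<longleftrightarrow>
    (\<forall>n t. glued Fs (fst fam n t, snd fam (n - 1) t) = (fst fam n (t + 1), snd fam n t)) \<and>
    (\<forall>n. fst fam n 0 = x n) \<and>
    (\<forall>n t. fst fam n t \<in> side (even (n + t)) \<and> snd fam n t \<in> side (even (n + t)))"
  (is "_ \<longleftrightarrow> ?eqs \<and> _ \<and> ?types")
proof
  assume s: "sol2 Fs x fam"
  have "glued Fs (fst fam n t, snd fam (n - 1) t) = (fst fam n (t + 1), snd fam n t) \<and>
      fst fam n t \<in> side (even (n + t)) \<and> snd fam n t \<in> side (even (n + t))" for n t
  proof (cases "even (n + t)")
    case True
    with s obtain a b where "fst fam n t = Inl a" "snd fam (n - 1) t = Inr b"
      "fst fam n (t + 1) = Inr (fst (Fs (a, b)))" "snd fam n t = Inl (snd (Fs (a, b)))"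
      unfolding sol2_def by blast
    with True show ?thesis by (cases "Fs (a, b)") (simp add: side_def)
  next
    case False
    with s obtain a b where "fst fam n t = Inr a" "snd fam (n - 1) t = Inl b"
      "fst fam n (t + 1) = Inl (fst (inv Fs (a, b)))" "snd fam n t = Inr (snd (inv Fs (a, b)))"
      unfolding sol2_def by blast
    with False show ?thesis by (cases "inv Fs (a, b)") (simp add: side_def)
  qed
  moreover have "\<forall>n. fst fam n 0 = x n" using s by (simp add: sol2_def)
  ultimately show "?eqs \<and> (\<forall>n. fst fam n 0 = x n) \<and> ?types" by blast
next
  assume s: "?eqs \<and> (\<forall>n. fst fam n 0 = x n) \<and> ?types"
  then have eqs: "glued Fs (fst fam n t, snd fam (n - 1) t) = (fst fam n (t + 1), snd fam n t)"
    and types: "fst fam n t \<in> side (even (n + t))" "snd fam n t \<in> side (even (n + t))" for n t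
    by blast+
  show "sol2 Fs x fam"
    unfolding sol2_def
  proof (intro conjI allI impI)
    fix n t :: int
    show "fst fam n 0 = x n" using s by blast
    {
      assume e: "even (n + t)"
      \<comment> \<open>The incoming carrier has the opposite parity, so the pair falls into the
        branch of \<open>glued\<close> that applies \<open>Fs\<close>.\<close>
      then have "even (n - 1 + t) = False" by auto
      with types(1)[of n t] types(2)[of "n - 1" t] e
      obtain a b where "fst fam n t = Inl a" "snd fam (n - 1) t = Inr b"
        by (auto simp: side_def)
      with eqs[of n t] show "\<exists>a b. fst fam n t = Inl a \<and> snd fam (n - 1) t = Inr b
          \<and> fst fam n (t + 1) = Inr (fst (Fs (a, b))) \<and> snd fam n t = Inl (snd (Fs (a, b)))"
        by (simp add: map_prod_def case_prod_beta)
    next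
      assume o: "odd (n + t)"
      then have "even (n - 1 + t) = True" "even (n + t) = False" by auto
      with types(1)[of n t] types(2)[of "n - 1" t]
      obtain a b where "fst fam n t = Inr a" "snd fam (n - 1) t = Inl b"
        by (auto simp: side_def)
      with eqs[of n t] show "\<exists>a b. fst fam n t = Inr a \<and> snd fam (n - 1) t = Inl b
          \<and> fst fam n (t + 1) = Inl (fst (inv Fs (a, b))) \<and> snd fam n t = Inr (snd (inv Fs (a, b)))"
        by (simp add: map_prod_def case_prod_beta)
    }
  qed
qed

section \<open>The type II model\<close>

theorem type_II_invariance_iff_balance:
  fixes Fs :: "'x0::polish_space \<times> 'u0::polish_space \<Rightarrow> 'xt::polish_space \<times> 'ut::polish_space"
    and mu :: "'x0 measure" and mut :: "'xt measure"
  defines "P \<equiv> alt_prod mu mut"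
  defines "nu \<equiv> distr P borel (\<lambda>x. projr (U2 Fs (-1) x))"
  defines "nut \<equiv> distr P borel (\<lambda>x. projl (U2 Fs 0 x))"
  assumes bij: "bij Fs" and Fs: "Fs \<in> borel \<rightarrow>\<^sub>M borel" "inv Fs \<in> borel \<rightarrow>\<^sub>M borel"
    and mu: "prob_space mu" "sets mu = sets borel" and mut: "prob_space mut" "sets mut = sets borel"
    and Xstar2: "emeasure P (Xstar2 Fs) = 1"
    and U2: "(\<lambda>x. projr (U2 Fs (-1) x)) \<in> P \<rightarrow>\<^sub>M borel" "(\<lambda>x. projl (U2 Fs 0 x)) \<in> P \<rightarrow>\<^sub>M borel"
    and T2: "T2 Fs \<in> P \<rightarrow>\<^sub>M P"
  shows "distr P P (T2 Fs) = P \<longleftrightarrow> distr (mu \<Otimes>\<^sub>M nu) (mut \<Otimes>\<^sub>M nut) Fs = mut \<Otimes>\<^sub>M nut"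
proof -
  let ?S = "sum_borel :: ('x0 + 'xt) measure" and ?V = "sum_borel :: ('ut + 'u0) measure"
  let ?m = "\<lambda>e. if e then distr mu ?S Inl else distr mut ?S Inr"
  interpret mu: prob_space mu by (rule mu)
  interpret mut: prob_space mut by (rule mut)
  have Inl_mu: "Inl \<in> mu \<rightarrow>\<^sub>M ?S" and Inr_mut: "Inr \<in> mut \<rightarrow>\<^sub>M ?S"
    by (simp_all add: mu mut cong: measurable_cong_sets)
  interpret L: lattice_law "glued Fs" side side ?m ?S ?V
  proof (intro lattice_law.intro lattice.intro lattice_law_axioms.intro)
    show "glued Fs (glued Fs p) = p" for p by (rule glued_involution[OF bij])
    show "fst (glued Fs (a, b)) \<in> side (\<not> e) \<and> snd (glued Fs (a, b)) \<in> side e"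
      if "a \<in> side e" "b \<in> side (\<not> e)" for a e b
      using that by (auto simp: side_def split: if_splits)
    show "prob_space (?m e)" for e
      using mu.prob_space_distr[OF Inl_mu] mut.prob_space_distr[OF Inr_mut] by simp
  qed (use measurable_glued[OF Fs] in auto)
  have P: "L.P = P" by (simp add: L.P_def P_def alt_prod_def)
  have sol: "L.solution x fam \<longleftrightarrow> sol2 Fs x fam" for x fam
    by (simp add: L.solution_def sol2_iff_glued)
  have Config: "x \<in> Config2" if "sol2 Fs x fam" for x fam
  proof -
    have "x n \<in> side (even n)" for n
      using L.solutionD(2,3)[OF that[folded sol], of n] L.solutionD(3)[OF that[folded sol], of n 0] by simp
    then have "(even n \<longrightarrow> x n \<in> range Inl) \<and> (odd n \<longrightarrow> x n \<in> range Inr)" for n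
      by (metis side_def)
    then show ?thesis by (simp add: Config2_def)
  qed
  have Xs: "L.Xstar = Xstar2 Fs" using Config by (auto simp: L.Xstar_def Xstar2_def sol)
  have U: "L.U n = U2 Fs n" for n by (intro ext) (simp add: L.U_def U2_def L.fam_of_def sol Xs)
  have T: "L.T = T2 Fs" by (intro ext) (simp add: L.T_def T2_def L.fam_of_def sol Xs)
  have U_side: "U2 Fs n x \<in> side (even n)" if "x \<in> Xstar2 Fs" for n x
    using L.solutionD(4)[OF L.solution_fam_of, of x n 0] that by (simp add: Xs U[symmetric] L.U_def)
  have U_Inr: "U2 Fs (-1) x = Inr (projr (U2 Fs (-1) x))" and U_Inl: "U2 Fs 0 x = Inl (projl (U2 Fs 0 x))"
    if "x \<in> Xstar2 Fs" for x
    using U_side[OF that, of "-1"] U_side[OF that, of 0] by (auto simp: side_def)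
  have X_sets: "Xstar2 Fs \<in> sets P"
    using Xstar2 emeasure_notin_sets[of "Xstar2 Fs" P] by fastforce
  interpret P: prob_space P using L.prob_space_P by (simp add: P)
  have AE: "AE x in P. x \<in> Xstar2 Fs"
    using P.AE_in_set_eq_1[OF X_sets] Xstar2 by (simp add: P.emeasure_eq_measure)
  have Inr_U: "(\<lambda>x. Inr (projr (U2 Fs (-1) x))) \<in> P \<rightarrow>\<^sub>M ?V" and Inl_U: "(\<lambda>x. Inl (projl (U2 Fs 0 x))) \<in> P \<rightarrow>\<^sub>M ?V"
    using U2 by measurable
  have U_meas: "U2 Fs (-1) \<in> P \<rightarrow>\<^sub>M ?V" "U2 Fs 0 \<in> P \<rightarrow>\<^sub>M ?V"
  \<comment> \<open>The hypotheses give measurability only of the projected carriers. Re-injecting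
    them recovers the carrier on \<open>Xstar2 Fs\<close>, and off that set it is constant.\<close>
  proof -
    have "(\<lambda>x. if x \<in> Xstar2 Fs then Inr (projr (U2 Fs (-1) x)) else undefined) \<in> P \<rightarrow>\<^sub>M ?V"
      "(\<lambda>x. if x \<in> Xstar2 Fs then Inl (projl (U2 Fs 0 x)) else undefined) \<in> P \<rightarrow>\<^sub>M ?V"
      using Inr_U Inl_U X_sets by (auto intro!: measurable_If_set)
    moreover have "U2 Fs (-1) = (\<lambda>x. if x \<in> Xstar2 Fs then Inr (projr (U2 Fs (-1) x)) else undefined)"
      "U2 Fs 0 = (\<lambda>x. if x \<in> Xstar2 Fs then Inl (projl (U2 Fs 0 x)) else undefined)"
      using U_Inr U_Inl by (auto simp: fun_eq_iff U2_def[of Fs _ x for x])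
    ultimately show "U2 Fs (-1) \<in> P \<rightarrow>\<^sub>M ?V" "U2 Fs 0 \<in> P \<rightarrow>\<^sub>M ?V" by metis+
  qed
  interpret I: lattice_invariance "glued Fs" side side ?m ?S ?V
  proof
    show "AE x in L.P. x \<in> L.Xstar" using AE by (simp only: P Xs)
  qed (use U_meas T2 in \<open>simp_all only: U T P\<close>)
  interpret nu: prob_space nu unfolding nu_def by (rule P.prob_space_distr[OF U2(1)])
  interpret nut: prob_space nut unfolding nut_def by (rule P.prob_space_distr[OF U2(2)])
  have nus: "sets nu = sets borel" "sets nut = sets borel" by (simp_all add: nu_def nut_def)
  have Inr_nu: "Inr \<in> nu \<rightarrow>\<^sub>M ?V" and Inl_nut: "Inl \<in> nut \<rightarrow>\<^sub>M ?V"
    by (simp_all add: nus cong: measurable_cong_sets)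
  have "distr P ?V (U2 Fs (-1)) = distr P ?V (\<lambda>x. Inr (projr (U2 Fs (-1) x)))"
    using AE U_Inr U_meas Inr_U by (intro distr_cong_AE) (auto elim!: eventually_mono)
  also have "\<dots> = distr nu ?V Inr"
    unfolding nu_def by (subst distr_distr) (use U2 in \<open>auto simp: comp_def\<close>)
  finally have law_U': "distr P ?V (U2 Fs (-1)) = distr nu ?V Inr" .
  have "distr P ?V (U2 Fs 0) = distr P ?V (\<lambda>x. Inl (projl (U2 Fs 0 x)))"
    using AE U_Inl U_meas Inl_U by (intro distr_cong_AE) (auto elim!: eventually_mono)
  also have "\<dots> = distr nut ?V Inl"
    unfolding nut_def by (subst distr_distr) (use U2 in \<open>auto simp: comp_def\<close>)
  finally have law_U: "distr P ?V (U2 Fs 0) = distr nut ?V Inl" .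
  have "I.local_law 0 = distr mu ?S Inl \<Otimes>\<^sub>M distr nu ?V Inr"
    by (simp add: I.local_law_eq U P law_U')
  also have "\<dots> = distr (mu \<Otimes>\<^sub>M nu) (?S \<Otimes>\<^sub>M ?V) (map_prod Inl Inr)"
    unfolding map_prod_def
    by (intro pair_measure_distr Inl_mu Inr_nu prob_space_imp_sigma_finite nu.prob_space_distr)
  finally have law0: "I.local_law 0 = distr (mu \<Otimes>\<^sub>M nu) (?S \<Otimes>\<^sub>M ?V) (map_prod Inl Inr)" .
  have "I.local_law 1 = distr mut ?S Inr \<Otimes>\<^sub>M distr nut ?V Inl"
    by (simp add: I.local_law_eq U P law_U)
  also have "\<dots> = distr (mut \<Otimes>\<^sub>M nut) (?S \<Otimes>\<^sub>M ?V) (map_prod Inr Inl)"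
    unfolding map_prod_def
    by (intro pair_measure_distr Inr_mut Inl_nut prob_space_imp_sigma_finite nut.prob_space_distr)
  finally have law1: "I.local_law 1 = distr (mut \<Otimes>\<^sub>M nut) (?S \<Otimes>\<^sub>M ?V) (map_prod Inr Inl)" .
  have pairs: "sets (mu \<Otimes>\<^sub>M nu) = sets (borel \<Otimes>\<^sub>M borel)" "sets (mut \<Otimes>\<^sub>M nut) = sets (borel \<Otimes>\<^sub>M borel)"
    by (simp_all add: mu mut nus cong: sets_pair_measure_cong)
  have Fs': "Fs \<in> mu \<Otimes>\<^sub>M nu \<rightarrow>\<^sub>M mut \<Otimes>\<^sub>M nut"
    unfolding measurable_cong_sets[OF pairs] borel_prod by (rule Fs(1))
  have e1: "map_prod Inl Inr \<in> mu \<Otimes>\<^sub>M nu \<rightarrow>\<^sub>M ?S \<Otimes>\<^sub>M ?V"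
    and e2: "map_prod Inr Inl \<in> mut \<Otimes>\<^sub>M nut \<rightarrow>\<^sub>M ?S \<Otimes>\<^sub>M ?V"
    unfolding measurable_cong_sets[OF pairs(1) refl] measurable_cong_sets[OF pairs(2) refl]
      map_prod_def case_prod_beta by measurable
  have r: "map_prod from_Inr from_Inl \<in> ?S \<Otimes>\<^sub>M ?V \<rightarrow>\<^sub>M mut \<Otimes>\<^sub>M nut"
    unfolding measurable_cong_sets[OF refl pairs(2)] map_prod_def case_prod_beta by measurable
  \<comment> \<open>The embedding has a measurable left inverse, so pushing forward along it is
    injective on measures; this brings balance back from the sum types to the original
    spaces.\<close>
  have cancel: "distr (distr Q (?S \<Otimes>\<^sub>M ?V) (map_prod Inr Inl)) (mut \<Otimes>\<^sub>M nut) (map_prod from_Inr from_Inl) = Q"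
    if Q: "sets Q = sets (mut \<Otimes>\<^sub>M nut)" for Q
  proof -
    have "map_prod Inr Inl \<in> Q \<rightarrow>\<^sub>M ?S \<Otimes>\<^sub>M ?V" using e2 by (simp add: Q cong: measurable_cong_sets)
    from distr_distr[OF r this] show ?thesis
      by (simp add: comp_def map_prod_def case_prod_beta distr_id2 Q)
  qed
  have "distr (I.local_law 0) (?S \<Otimes>\<^sub>M ?V) (glued Fs) =
      distr (mu \<Otimes>\<^sub>M nu) (?S \<Otimes>\<^sub>M ?V) (\<lambda>p. glued Fs (map_prod Inl Inr p))"
    unfolding law0 by (subst distr_distr[OF L.F_meas e1]) (simp add: comp_def)
  also have "(\<lambda>p. glued Fs (map_prod Inl Inr p)) = map_prod Inr Inl \<circ> Fs"
    by (auto simp: fun_eq_iff)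
  also have "distr (mu \<Otimes>\<^sub>M nu) (?S \<Otimes>\<^sub>M ?V) (map_prod Inr Inl \<circ> Fs) =
      distr (distr (mu \<Otimes>\<^sub>M nu) (mut \<Otimes>\<^sub>M nut) Fs) (?S \<Otimes>\<^sub>M ?V) (map_prod Inr Inl)"
    by (rule distr_distr[OF e2 Fs', symmetric])
  finally have "distr (I.local_law 0) (?S \<Otimes>\<^sub>M ?V) (glued Fs) = I.local_law 1 \<longleftrightarrow>
      distr (mu \<Otimes>\<^sub>M nu) (mut \<Otimes>\<^sub>M nut) Fs = mut \<Otimes>\<^sub>M nut"
    unfolding law1 using cancel[of "distr (mu \<Otimes>\<^sub>M nu) (mut \<Otimes>\<^sub>M nut) Fs"] cancel[of "mut \<Otimes>\<^sub>M nut"]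
    by auto
  then show ?thesis using I.balance_iff_invariance by (simp add: P T)
qed

theorem theorem2p1:
  shows "(\<forall>(F :: 'x::polish_space \<times> 'u::polish_space \<Rightarrow> 'x \<times> 'u) (mu :: 'x measure).
            (\<forall>p. F (F p) = p) \<longrightarrow> F \<in> borel \<rightarrow>\<^sub>M borel \<longrightarrow>
            prob_space mu \<longrightarrow> sets mu = sets borel \<longrightarrow>
            (let MZ = PiM (UNIV :: int set) (\<lambda>_. mu);
                 nu = distr MZ borel (U1 F (-1))
             in emeasure MZ (Xstar1 F) = 1 \<longrightarrow>
                U1 F (-1) \<in> MZ \<rightarrow>\<^sub>M borel \<longrightarrow>
                T1 F \<in> MZ \<rightarrow>\<^sub>M MZ \<longrightarrow>
                (distr MZ MZ (T1 F) = MZ \<longleftrightarrow>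
                 distr (mu \<Otimes>\<^sub>M nu) (mu \<Otimes>\<^sub>M nu) F = mu \<Otimes>\<^sub>M nu)))
       \<and>
         (\<forall>(Fs :: 'x0::polish_space \<times> 'u0::polish_space \<Rightarrow> 'xt::polish_space \<times> 'ut::polish_space)
            (mu :: 'x0 measure) (mut :: 'xt measure).
            bij Fs \<longrightarrow> Fs \<in> borel \<rightarrow>\<^sub>M borel \<longrightarrow> inv Fs \<in> borel \<rightarrow>\<^sub>M borel \<longrightarrow>
            prob_space mu \<longrightarrow> sets mu = sets borel \<longrightarrow>
            prob_space mut \<longrightarrow> sets mut = sets borel \<longrightarrow>
            (let P = alt_prod mu mut;
                 nu = distr P borel (\<lambda>x. projr (U2 Fs (-1) x));
                 nut = distr P borel (\<lambda>x. projl (U2 Fs 0 x))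
             in emeasure P (Xstar2 Fs) = 1 \<longrightarrow>
                (\<lambda>x. projr (U2 Fs (-1) x)) \<in> P \<rightarrow>\<^sub>M borel \<longrightarrow>
                (\<lambda>x. projl (U2 Fs 0 x)) \<in> P \<rightarrow>\<^sub>M borel \<longrightarrow>
                T2 Fs \<in> P \<rightarrow>\<^sub>M P \<longrightarrow>
                (distr P P (T2 Fs) = P \<longleftrightarrow>
                 distr (mu \<Otimes>\<^sub>M nu) (mut \<Otimes>\<^sub>M nut) Fs = mut \<Otimes>\<^sub>M nut)))"
  unfolding Let_def
  by (intro conjI allI impI;
      rule type_I_invariance_iff_balance type_II_invariance_iff_balance; blast)

end
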